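(* Let $G$ be a cubic graph. The edges of $G$ can be covered with four perfect matchings if and only if $G$ admits a tetrahedral flow. Moreover, for an arbitrary fixed tetrahedron $T$ in $PG(3,2)$, there exists a one-to-one correspondence between the coverings of $G$ with four perfect matchings and the $T$-flows on $G$.
   Context: Graphs are finite; multiple edges and loops may occur. A covering of $G$ with four perfect matchings is an indexed family $(M_1,M_2,M_3,M_4)$ of perfect matchings of $G$, not necessarily distinct, with $E(G)=M_1\cup M_2\cup M_3\cup M_4$. The points of $PG(3,2)$ are the nonzero vectors of $\mathbb{F}_2^4$; its lines are the triples $\{x,y,z\}$ of points with $x+y+z=0$. A tetrahedron $T=T(p_1,p_2,p_3,p_4)$ is spanned by four points $p_1,\dots,p_4$ in general position, i.e. forming a basis of $\mathbb{F}_2^4$; it has ten points, namely the $p_i$ and the sums $p_i+p_j$ $(i<j)$, and six lines, namely $\{p_i,\,p_i+p_j,\,p_j\}$ $(i<j)$. A $T$-flow on a cubic graph $G$ is a map $\phi\colon E(G)\to\mathbb{Z}_2^4$ such that $\phi(e)$ is a point of $T$ for each edge $e$, and for each vertex $v$ the values of $\phi$ on the three edges incident with $v$ form a line of $T$. A tetrahedral flow is a $T$-flow for some tetrahedron $T$. *)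

theory Defs
  imports "HOL-Analysis.Cartesian_Space" "HOL-Library.Z2" "HOL-Library.Numeral_Type"
    "HOL-Library.Multiset" "HOL-Library.FuncSet"
begin

section \<open>Finite graphs with loops and multiple edges\<close>

text \<open>
  Edges are abstract objects, so parallel edges are distinct elements of \<open>edges G\<close>.
  Every edge has a two-element multiset of ends, which is \<open>{#v, v#}\<close> for a loop at \<open>v\<close>.
\<close>

record ('v, 'e) multigraph =
  verts :: "'v set"
  edges :: "'e set"
  ends :: "'e \<Rightarrow> 'v multiset"

definition finite_graph :: "('v, 'e) multigraph \<Rightarrow> bool" where
  "finite_graph G \<longleftrightarrow> finite (verts G) \<and> finite (edges G) \<and>
     (\<forall>e\<in>edges G. size (ends G e) = 2 \<and> set_mset (ends G e) \<subseteq> verts G)"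

definition incident_edges :: "('v, 'e) multigraph \<Rightarrow> 'v \<Rightarrow> 'e set" where
  "incident_edges G v = {e \<in> edges G. v \<in># ends G e}"

definition is_loop :: "('v, 'e) multigraph \<Rightarrow> 'e \<Rightarrow> bool" where
  "is_loop G e \<longleftrightarrow> (\<exists>v. ends G e = {#v, v#})"

text \<open>A loop contributes two to the degree of its vertex.\<close>

definition degree :: "('v, 'e) multigraph \<Rightarrow> 'v \<Rightarrow> nat" where
  "degree G v = (\<Sum>e\<in>edges G. count (ends G e) v)"

definition cubic_graph :: "('v, 'e) multigraph \<Rightarrow> bool" where
  "cubic_graph G \<longleftrightarrow> finite_graph G \<and> (\<forall>v\<in>verts G. degree G v = 3)"

definition matching :: "('v, 'e) multigraph \<Rightarrow> 'e set \<Rightarrow> bool" where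
  "matching G M \<longleftrightarrow> M \<subseteq> edges G \<and> (\<forall>e\<in>M. \<not> is_loop G e) \<and>
     (\<forall>e\<in>M. \<forall>f\<in>M. e \<noteq> f \<longrightarrow> set_mset (ends G e) \<inter> set_mset (ends G f) = {})"

definition perfect_matching :: "('v, 'e) multigraph \<Rightarrow> 'e set \<Rightarrow> bool" where
  "perfect_matching G M \<longleftrightarrow> matching G M \<and> (\<forall>v\<in>verts G. \<exists>e\<in>M. v \<in># ends G e)"

definition four_covering :: "('v, 'e) multigraph \<Rightarrow> (4 \<Rightarrow> 'e set) \<Rightarrow> bool" where
  "four_covering G M \<longleftrightarrow> (\<forall>i. perfect_matching G (M i)) \<and> edges G = (\<Union>i. M i)"


section \<open>Tetrahedra in \<open>PG(3,2)\<close>\<close>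

definition PG32_points :: "(bit ^ 4) set" where
  "PG32_points = {x. x \<noteq> 0}"

definition PG32_lines :: "(bit ^ 4) set set" where
  "PG32_lines = {{x, y, z} | x y z.
     x \<in> PG32_points \<and> y \<in> PG32_points \<and> z \<in> PG32_points \<and> x + y + z = 0}"

definition general_position :: "(4 \<Rightarrow> bit ^ 4) \<Rightarrow> bool" where
  "general_position p \<longleftrightarrow> (\<forall>i. p i \<in> PG32_points) \<and> inj p \<and>
     vec.independent (range p) \<and> vec.span (range p) = UNIV"

record tetrahedron =
  points :: "(bit ^ 4) set"
  lines :: "(bit ^ 4) set set"

definition spanned_tetrahedron :: "(4 \<Rightarrow> bit ^ 4) \<Rightarrow> tetrahedron" where
  "spanned_tetrahedron p = \<lparr>
     points = range p \<union> {p i + p j | i j. i \<noteq> j},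
     lines = {{p i, p i + p j, p j} | i j. i \<noteq> j}\<rparr>"

definition is_tetrahedron :: "tetrahedron \<Rightarrow> bool" where
  "is_tetrahedron T \<longleftrightarrow> (\<exists>p. general_position p \<and> T = spanned_tetrahedron p)"

lemma bit_vec_add_self: "x + x = (0 :: bit ^ 'n)"
  by (simp add: vec_eq_iff)

lemma tetrahedron_in_PG32:
  assumes "is_tetrahedron T"
  shows "points T \<subseteq> PG32_points" and "lines T \<subseteq> PG32_lines"
proof -
  obtain p where p: "general_position p" and T: "T = spanned_tetrahedron p"
    using assms by (auto simp: is_tetrahedron_def)
  have pt: "p i \<in> PG32_points" for i
    using p by (simp add: general_position_def)
  have sum: "p i + p j \<in> PG32_points" if "i \<noteq> j" for i j
  proof -
    have ne: "p i \<noteq> p j"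
      using p that by (auto simp: general_position_def inj_def)
    have "p i + p j \<noteq> 0"
    proof
      assume "p i + p j = 0"
      then have "p i + p j = p j + p j" by (simp only: bit_vec_add_self)
      with ne show False by (simp only: add_right_cancel)
    qed
    then show ?thesis by (simp only: PG32_points_def mem_Collect_eq not_False_eq_True)
  qed
  show "points T \<subseteq> PG32_points"
    using pt sum by (auto simp: T spanned_tetrahedron_def)
  show "lines T \<subseteq> PG32_lines"
  proof
    fix l assume "l \<in> lines T"
    then obtain i j where ij: "i \<noteq> j" and l: "l = {p i, p i + p j, p j}"
      by (auto simp: T spanned_tetrahedron_def)
    have "p i + (p i + p j) + p j = (p i + p j) + (p i + p j)"
      by (simp only: ac_simps)
    then have "p i + (p i + p j) + p j = 0"
      by (simp only: bit_vec_add_self)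
    then show "l \<in> PG32_lines"
      unfolding PG32_lines_def mem_Collect_eq l using pt sum[OF ij] by blast
  qed
qed


section \<open>Tetrahedral flows\<close>

text \<open>
  Flows are taken to be \<open>undefined\<close> outside \<open>edges G\<close>, so that distinct flows are distinct
  maps on the edge set. The lines of \<open>T\<close> have three elements, so the condition at \<open>v\<close>
  forces the three edges at \<open>v\<close> of a cubic graph to have distinct values, and it fails at
  a vertex with a loop.
\<close>

definition T_flow ::
    "('v, 'e) multigraph \<Rightarrow> tetrahedron \<Rightarrow> ('e \<Rightarrow> bit ^ 4) \<Rightarrow> bool" where
  "T_flow G T \<phi> \<longleftrightarrow> \<phi> \<in> edges G \<rightarrow>\<^sub>E points T \<and>
     (\<forall>v\<in>verts G. \<phi> ` incident_edges G v \<in> lines T)"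

definition tetrahedral_flow :: "('v, 'e) multigraph \<Rightarrow> ('e \<Rightarrow> bit ^ 4) \<Rightarrow> bool" where
  "tetrahedral_flow G \<phi> \<longleftrightarrow> (\<exists>T. is_tetrahedron T \<and> T_flow G T \<phi>)"

end

theory Submission
  imports Defs
begin

text \<open>
  In a covering, every edge \<open>e\<close> carries the set of indices of the matchings containing it.
  At each vertex these three sets partition the four indices, so they are
  \<open>{k}\<close>, \<open>{l}\<close> and \<open>- {k, l}\<close>. Complementing the two-element sets turns this triple into
  \<open>{k}\<close>, \<open>{l}\<close>, \<open>{k, l}\<close>, whose sums of corner points form a line of the tetrahedron. Since
  subset sums of a basis are distinct, the passage is reversible.
\<close>

section \<open>Subset sums of a basis, and the points and lines of a tetrahedron\<close>

lemma inj_subset_sum: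
  fixes p :: "'k::finite \<Rightarrow> bit ^ 'n"
  assumes ind: "vec.independent (range p)" and inj: "inj p"
  shows "inj (\<lambda>A. \<Sum>i\<in>A. p i)"
proof (rule injI)
  fix A B assume eq: "(\<Sum>i\<in>A. p i) = (\<Sum>i\<in>B. p i)"
  \<comment> \<open>The difference of the two indicator functions gives the coefficients of a linear
    relation among the vectors \<open>p i\<close>. It vanishes at \<open>i\<close> exactly when
    \<open>A\<close> and \<open>B\<close> agree at \<open>i\<close>.\<close>
  define u :: "'k \<Rightarrow> bit" where "u i = of_bool (i \<in> A) - of_bool (i \<in> B)" for i
  have indicator: "(\<Sum>i\<in>C. p i) = (\<Sum>i\<in>UNIV. of_bool (i \<in> C) *s p i)" for C
  proof -
    have "(\<Sum>i\<in>UNIV. of_bool (i \<in> C) *s p i) = (\<Sum>i\<in>UNIV. if i \<in> C then p i else 0)"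
      by (intro sum.cong) auto
    then show ?thesis
      by (simp add: sum.If_cases)
  qed
  \<comment> \<open>Independence concerns sums over the vectors in \<open>range p\<close>, so the
    coefficients are moved from indices to vectors along \<open>inv p\<close>.\<close>
  have "(\<Sum>x\<in>range p. u (inv p x) *s x) = (\<Sum>i\<in>UNIV. u i *s p i)"
    using inj by (subst sum.reindex) (auto simp: inv_f_f)
  also have "\<dots> = (\<Sum>i\<in>A. p i) - (\<Sum>i\<in>B. p i)"
    unfolding indicator by (simp only: u_def vector_sub_rdistrib sum_subtractf)
  also have "\<dots> = 0"
    using eq by (simp only: right_minus_eq)
  finally have zero: "(\<Sum>x\<in>range p. u (inv p x) *s x) = 0" .
  have "u i = 0" for i
    using vec.independentD[OF ind _ order_refl zero, of "p i"] inj by (simp add: inv_f_f)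
  then have "i \<in> A \<longleftrightarrow> i \<in> B" for i
    by (cases "i \<in> A"; cases "i \<in> B") (simp_all add: u_def)
  then show "A = B"
    by blast
qed

text \<open>A corner is the sum over a singleton, and the point between two corners is the sum over
  a pair. Points and lines are thereby named by index sets, the form in which they can be compared
  with edge labels.\<close>

lemma spanned_tetrahedron_subset_sum:
  shows "points (spanned_tetrahedron p) =
      (\<lambda>A. \<Sum>i\<in>A. p i) ` {A. card A = 1 \<or> card A = 2}"
    and "lines (spanned_tetrahedron p) =
      {(\<lambda>A. \<Sum>i\<in>A. p i) ` {{k}, {l}, {k, l}} | k l. k \<noteq> l}"
proof -
  define s where "s A = (\<Sum>i\<in>A. p i)" for A
  have single: "s {i} = p i" for i
    by (simp add: s_def)
  have pair: "s {i, j} = p i + p j" if "i \<noteq> j" for i j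
    using that by (simp add: s_def)
  have small: "{A :: 4 set. card A = 1 \<or> card A = 2} = range (\<lambda>i. {i}) \<union> {{i, j} | i j. i \<noteq> j}"
    by (auto simp: card_1_singleton_iff card_2_iff)
  have "s ` {{i, j} | i j. i \<noteq> j} = {s {i, j} | i j. i \<noteq> j}"
    by blast
  also have "\<dots> = {p i + p j | i j. i \<noteq> j}"
    using pair by (intro Collect_cong) metis
  finally have "s ` {{i, j} | i j. i \<noteq> j} = {p i + p j | i j. i \<noteq> j}" .
  then show "points (spanned_tetrahedron p) =
      (\<lambda>A. \<Sum>i\<in>A. p i) ` {A. card A = 1 \<or> card A = 2}"
    unfolding s_def[symmetric] small image_Un image_image single
    by (simp add: spanned_tetrahedron_def)
  have "s ` {{k}, {l}, {k, l}} = {p k, p k + p l, p l}" if "k \<noteq> l" for k l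
    unfolding image_insert image_empty single pair[OF that] by blast
  \<comment> \<open>The two triples are known to agree only for distinct indices, so
    \<open>k \<noteq> l\<close> stays inside the equivalence. In this form it rewrites the set
    comprehension under its quantifiers.\<close>
  then have "L = s ` {{k}, {l}, {k, l}} \<and> k \<noteq> l \<longleftrightarrow> L = {p k, p k + p l, p l} \<and> k \<noteq> l" for L k l
    by (cases "k = l") simp_all
  then show "lines (spanned_tetrahedron p) =
      {(\<lambda>A. \<Sum>i\<in>A. p i) ` {{k}, {l}, {k, l}} | k l. k \<noteq> l}"
    unfolding s_def[symmetric] spanned_tetrahedron_def tetrahedron.simps by (simp only:)
qed

text \<open>The standard basis shows that some tetrahedron exists, which is what turns a covering
  into a tetrahedral flow.\<close>

lemma general_position_axis: "general_position (\<lambda>i. axis i 1)"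
proof -
  have range: "range (\<lambda>i::4. axis i (1::bit)) = cart_basis"
    by (auto simp: cart_basis_def)
  show ?thesis
    unfolding general_position_def range PG32_points_def
    using independent_cart_basis span_cart_basis
    by (auto simp: inj_def axis_eq_axis axis_eq_0_iff)
qed

section \<open>Partitions of four indices into three blocks\<close>

lemma card_Compl_finite:
  fixes A :: "'a::finite set"
  shows "card (- A) = CARD('a) - card A"
  by (simp add: Compl_eq_Diff_UNIV card_Diff_subset)

text \<open>Three positive integers with sum 4 are 1, 1 and 2 in some order. So two blocks are
  singletons and the third is the complement of their union; the unordered form of the conclusion
  leaves open which block is the pair.\<close>

lemma three_part_partition:
  fixes A B C :: "4 set"
  assumes "A \<noteq> {}" "B \<noteq> {}" "C \<noteq> {}"
    and "A \<inter> B = {}" "A \<inter> C = {}" "B \<inter> C = {}"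
    and "A \<union> B \<union> C = UNIV"
  shows "\<exists>k l. k \<noteq> l \<and> {A, B, C} = {{k}, {l}, - {k, l}}"
proof -
  have two: "\<exists>k l. k \<noteq> l \<and> {X, Y, Z} = {{k}, {l}, - {k, l}}"
    if XYZ: "card X = 1" "card Y = 1" "X \<inter> Y = {}" "X \<inter> Z = {}" "Y \<inter> Z = {}"
      "X \<union> Y \<union> Z = UNIV" for X Y Z :: "4 set"
  proof -
    obtain k l where "X = {k}" "Y = {l}"
      using XYZ(1,2) by (auto simp: card_1_singleton_iff)
    moreover have "Z = - (X \<union> Y)"
      using XYZ(4-6) by blast
    ultimately have "k \<noteq> l" "{X, Y, Z} = {{k}, {l}, - {k, l}}"
      using XYZ(3) by auto
    then show ?thesis by blast
  qed
  have "card (A \<union> B \<union> C) = card A + card B + card C"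
    using assms by (subst card_Un_disjoint, simp, simp, blast)+ simp
  then have sum: "card A + card B + card C = 4"
    using assms by simp
  have "card A \<noteq> 0" "card B \<noteq> 0" "card C \<noteq> 0"
    using assms by simp_all
  with sum consider "card A = 1" "card B = 1" | "card A = 1" "card C = 1"
    | "card B = 1" "card C = 1"
    by linarith
  then show ?thesis
  proof cases
    case 1
    then show ?thesis by (intro two) (use assms in auto)
  next
    case 2
    then have "\<exists>k l. k \<noteq> l \<and> {A, C, B} = {{k}, {l}, - {k, l}}"
      by (intro two) (use assms in auto)
    then show ?thesis by (simp only: insert_commute[of C B])
  next
    case 3
    then have "\<exists>k l. k \<noteq> l \<and> {B, C, A} = {{k}, {l}, - {k, l}}"
      by (intro two) (use assms in auto)
    then show ?thesis by (simp only: insert_commute[of C A] insert_commute[of B A])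
  qed
qed

section \<open>Incident edges, degrees and loops\<close>

lemma edge_has_end:
  assumes "finite_graph G" "e \<in> edges G"
  obtains v where "v \<in> verts G" "e \<in> incident_edges G v"
proof -
  have "size (ends G e) = 2" and sub: "set_mset (ends G e) \<subseteq> verts G"
    using assms by (auto simp: finite_graph_def)
  then have "ends G e \<noteq> {#}"
    by auto
  then obtain v where "v \<in># ends G e"
    by blast
  with that assms sub show thesis
    by (auto simp: incident_edges_def)
qed

lemma degree_incident_edges:
  assumes "finite_graph G"
  shows "degree G v = (\<Sum>e\<in>incident_edges G v. count (ends G e) v)"
  unfolding degree_def incident_edges_def using assms
  by (intro sum.mono_neutral_right) (auto simp: finite_graph_def not_in_iff)

lemma card_incident_edges_loopless:
  assumes "finite_graph G" "\<forall>e\<in>edges G. \<not> is_loop G e"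
  shows "card (incident_edges G v) = degree G v"
proof -
  have "count (ends G e) v = 1" if e: "e \<in> incident_edges G v" for e
  proof -
    have mem: "v \<in># ends G e" and "size (ends G e) = 2" and nl: "\<not> is_loop G e"
      using e assms by (auto simp: incident_edges_def finite_graph_def)
    from mem obtain N where N: "ends G e = add_mset v N"
      by (rule multi_member_split[THEN exE])
    with \<open>size (ends G e) = 2\<close> obtain w where "N = {#w#}"
      using size_1_singleton_mset by auto
    with N have w: "ends G e = {#v, w#}"
      by simp
    with nl have "v \<noteq> w"
      by (auto simp: is_loop_def)
    with w show ?thesis by simp
  qed
  then show ?thesis
    using assms by (simp add: degree_incident_edges)
qed

text \<open>Three values need at least three incident edges, while the multiplicities of
  \<open>v\<close> in them are at least 1 and add up to 3. Hence there are exactly three edges, with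
  distinct values, and no multiplicity can be 2.\<close>

lemma cubic_three_values:
  assumes cubic: "cubic_graph G" and v: "v \<in> verts G"
    and three: "card (f ` incident_edges G v) = 3"
  shows "inj_on f (incident_edges G v)"
    and "e \<in> incident_edges G v \<Longrightarrow> \<not> is_loop G e"
proof -
  let ?I = "incident_edges G v"
  have fin: "finite ?I" and fg: "finite_graph G"
    using cubic by (auto simp: cubic_graph_def finite_graph_def incident_edges_def)
  have deg: "(\<Sum>e\<in>?I. count (ends G e) v) = 3"
    using cubic v fg by (simp add: cubic_graph_def flip: degree_incident_edges)
  have pos: "count (ends G e) v \<ge> 1" if "e \<in> ?I" for e
    using that by (simp add: incident_edges_def Suc_leI)
  have "card ?I \<le> (\<Sum>e\<in>?I. count (ends G e) v)"
    using sum_mono[of ?I "\<lambda>_. 1" "\<lambda>e. count (ends G e) v"] pos by simp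
  moreover have "card (f ` ?I) \<le> card ?I"
    using fin by (rule card_image_le)
  ultimately have card: "card ?I = 3"
    using three deg by simp
  with three fin show "inj_on f ?I"
    by (simp add: eq_card_imp_inj_on)
  assume e: "e \<in> ?I"
  show "\<not> is_loop G e"
  proof
    assume "is_loop G e"
    with e have "count (ends G e) v = 2"
      by (auto simp: is_loop_def incident_edges_def)
    then have "card ?I < (\<Sum>e\<in>?I. count (ends G e) v)"
      using sum_strict_mono_ex1[OF fin, of "\<lambda>_. 1" "\<lambda>e. count (ends G e) v"] pos e by force
    with card deg show False by simp
  qed
qed

section \<open>Coverings as edge labellings by index sets\<close>

text \<open>Being a covering becomes a condition local to each vertex, like that for a flow: the
  labels around \<open>v\<close> partition the four indices. Conversely, such a triple has three
  distinct members, which excludes loops and makes the labels of different edges at \<open>v\<close>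
  disjoint.\<close>

lemma four_covering_iff_labels:
  assumes cubic: "cubic_graph G"
  shows "four_covering G M \<longleftrightarrow> (\<forall>i. M i \<subseteq> edges G) \<and>
    (\<forall>v\<in>verts G. \<exists>k l. k \<noteq> l \<and>
      (\<lambda>e. {i. e \<in> M i}) ` incident_edges G v = {{k}, {l}, - {k, l}})"
    (is "_ \<longleftrightarrow> _ \<and> (\<forall>v\<in>verts G. ?triple v)")
proof -
  have fg: "finite_graph G"
    using cubic by (simp add: cubic_graph_def)
  let ?lab = "\<lambda>e. {i. e \<in> M i}"
  show ?thesis
  proof (intro iffI conjI ballI allI)
    fix i assume "four_covering G M"
    then show "M i \<subseteq> edges G" by (auto simp: four_covering_def)
  next
    fix v assume cov: "four_covering G M" and v: "v \<in> verts G"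
    let ?I = "incident_edges G v"
    have m: "matching G (M i)" and ex: "\<exists>e\<in>M i. v \<in># ends G e" and un: "edges G = (\<Union>i. M i)" for i
      using cov v by (auto simp: four_covering_def perfect_matching_def)
    have "\<forall>e\<in>edges G. \<not> is_loop G e"
      using m by (auto simp: un matching_def)
    then have "card ?I = 3"
      using cubic v fg by (simp add: card_incident_edges_loopless cubic_graph_def)
    then obtain a b c where I: "?I = {a, b, c}" and ne: "a \<noteq> b" "a \<noteq> c" "b \<noteq> c"
      by (auto simp: card_3_iff)
    \<comment> \<open>Blocks are nonempty because every edge is covered, disjoint because each
      \<open>M i\<close> is a matching, and exhaustive because each \<open>M i\<close> reaches
      \<open>v\<close>.\<close>
    have nonempty: "?lab e \<noteq> {}" if "e \<in> ?I" for e
      using that un by (auto simp: incident_edges_def)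
    have disj: "?lab e \<inter> ?lab f = {}" if "e \<in> ?I" "f \<in> ?I" "e \<noteq> f" for e f
      using that m by (fastforce simp: matching_def incident_edges_def)
    have "\<exists>e\<in>?I. i \<in> ?lab e" for i
      using ex[of i] un by (auto simp: incident_edges_def)
    then have cover: "?lab a \<union> ?lab b \<union> ?lab c = UNIV"
      unfolding I by blast
    show "?triple v"
      unfolding I image_insert image_empty
      using nonempty disj cover ne by (intro three_part_partition) (simp_all add: I)
  next
    assume R: "(\<forall>i. M i \<subseteq> edges G) \<and> (\<forall>v\<in>verts G. ?triple v)"
    have inj: "inj_on ?lab (incident_edges G v)"
      and loopless: "e \<in> incident_edges G v \<Longrightarrow> \<not> is_loop G e"
      and disj: "e \<in> incident_edges G v \<Longrightarrow> f \<in> incident_edges G v \<Longrightarrow> ?lab e \<noteq> ?lab f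
         \<Longrightarrow> ?lab e \<inter> ?lab f = {}"
      and nonempty: "e \<in> incident_edges G v \<Longrightarrow> ?lab e \<noteq> {}"
      and cover: "\<exists>e\<in>incident_edges G v. i \<in> ?lab e"
      if v: "v \<in> verts G" for v e f i
    proof -
      obtain k l where kl: "k \<noteq> l"
        and im: "?lab ` incident_edges G v = {{k}, {l}, - {k, l}}"
        using R v by blast
      have "card (- {k, l}) = 2"
        using kl by (simp add: card_Compl_finite)
      then have ne: "- {k, l} \<noteq> {}"
        by (metis card.empty zero_neq_numeral)
      have "- {k, l} \<noteq> {k}" "- {k, l} \<noteq> {l}"
        by blast+
      with kl have "card {{k}, {l}, - {k, l}} = 3"
        by (auto simp: card_insert_if)
      with im have three: "card (?lab ` incident_edges G v) = 3"
        by simp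
      show "inj_on ?lab (incident_edges G v)"
        by (rule cubic_three_values(1)[OF cubic v three])
      show "e \<in> incident_edges G v \<Longrightarrow> \<not> is_loop G e"
        by (rule cubic_three_values(2)[OF cubic v three])
      have lab: "?lab e \<in> {{k}, {l}, - {k, l}}" if "e \<in> incident_edges G v" for e
        using imageI[OF that, of ?lab] unfolding im .
      have disj: "\<forall>X\<in>{{k}, {l}, - {k, l}}. \<forall>Y\<in>{{k}, {l}, - {k, l}}. X \<noteq> Y \<longrightarrow> X \<inter> Y = {}"
        using kl by simp
      show "?lab e \<inter> ?lab f = {}"
        if "e \<in> incident_edges G v" "f \<in> incident_edges G v" "?lab e \<noteq> ?lab f"
        using bspec[OF bspec[OF disj lab[OF that(1)]] lab[OF that(2)]] that(3) by (rule mp)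
      show "?lab e \<noteq> {}" if "e \<in> incident_edges G v"
        using lab[OF that] ne by (elim insertE) simp_all
      have "i \<in> \<Union> (?lab ` incident_edges G v)"
        unfolding im by blast
      then show "\<exists>e\<in>incident_edges G v. i \<in> ?lab e"
        by blast
    qed
    have union: "edges G = (\<Union>i. M i)"
    proof
      show "(\<Union>i. M i) \<subseteq> edges G" using R by blast
      show "edges G \<subseteq> (\<Union>i. M i)"
      proof
        fix e assume "e \<in> edges G"
        then obtain v where "v \<in> verts G" "e \<in> incident_edges G v"
          by (rule edge_has_end[OF fg])
        with nonempty show "e \<in> (\<Union>i. M i)" by blast
      qed
    qed
    have "matching G (M i)" for i
      unfolding matching_def
    proof (intro conjI ballI impI)
      show "M i \<subseteq> edges G" using R by blast
    next
      fix e assume "e \<in> M i"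
      then have "e \<in> edges G" using R by blast
      then show "\<not> is_loop G e"
        using edge_has_end[OF fg] loopless by metis
    next
      fix e f assume ef: "e \<in> M i" "f \<in> M i" "e \<noteq> f"
      then have E: "e \<in> edges G" "f \<in> edges G" using R by blast+
      show "set_mset (ends G e) \<inter> set_mset (ends G f) = {}"
      proof (rule ccontr)
        assume "set_mset (ends G e) \<inter> set_mset (ends G f) \<noteq> {}"
        then obtain v where v: "v \<in># ends G e" "v \<in># ends G f" by blast
        then have I: "e \<in> incident_edges G v" "f \<in> incident_edges G v" and V: "v \<in> verts G"
          using E fg by (auto simp: incident_edges_def finite_graph_def)
        \<comment> \<open>Distinct edges at a common end have distinct, hence disjoint labels, yet
          both labels contain \<open>i\<close>.\<close>
        have "?lab e \<noteq> ?lab f"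
          using inj_onD[OF inj[OF V] _ I] ef(3) by blast
        with disj[OF V I] ef show False by blast
      qed
    qed
    moreover have "\<exists>e\<in>M i. v \<in># ends G e" if "v \<in> verts G" for v i
      using cover[OF that, of i] by (auto simp: incident_edges_def)
    ultimately show "four_covering G M"
      unfolding four_covering_def perfect_matching_def using union by blast
  qed
qed

section \<open>The correspondence between coverings and flows\<close>

text \<open>Among four indices the complement of a pair is again a pair, so this is an involution.
  It fixes singletons and exchanges the partition triples of a covering with the triples that name
  lines.\<close>

definition complement_pair :: "4 set \<Rightarrow> 4 set" where
  "complement_pair A = (if card A = 2 then - A else A)"

lemma complement_pair_involution: "complement_pair (complement_pair A) = A"
  by (simp add: complement_pair_def card_Compl_finite)

lemma complement_pair_triple:
  assumes "k \<noteq> l"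
  shows "complement_pair ` {{k}, {l}, - {k, l}} = {{k}, {l}, {k, l}}"
    and "complement_pair ` {{k}, {l}, {k, l}} = {{k}, {l}, - {k, l}}"
  using assms by (simp_all add: complement_pair_def card_Compl_finite)

lemma coverings_flows_bij_betw:
  assumes cubic: "cubic_graph G" and p: "general_position p"
  shows "bij_betw
    (\<lambda>M. \<lambda>e\<in>edges G. \<Sum>i\<in>complement_pair {i. e \<in> M i}. p i)
    {M. four_covering G M} {\<phi>. T_flow G (spanned_tetrahedron p) \<phi>}"
    (is "bij_betw ?f _ _")
proof -
  define s where "s A = (\<Sum>i\<in>A. p i)" for A
  have s: "inj s"
    using inj_subset_sum[of p] p by (simp add: general_position_def s_def[abs_def])
  note tetra = spanned_tetrahedron_subset_sum[of p, folded s_def]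
  have f: "?f M = (\<lambda>e\<in>edges G. s (complement_pair {i. e \<in> M i}))" for M
    by (simp add: s_def)
  \<comment> \<open>The inverse map: \<open>inv s\<close> recovers the index set naming the point
    \<open>\<phi> e\<close>, the involution turns it into the label of \<open>e\<close>, and the
    labels are sorted by index into four edge sets.\<close>
  define g where "g \<phi> = (\<lambda>i. {e \<in> edges G. i \<in> complement_pair (inv s (\<phi> e))})" for \<phi> :: "'b \<Rightarrow> _"
  have fg: "finite_graph G"
    using cubic by (simp add: cubic_graph_def)
  have I: "incident_edges G v \<subseteq> edges G" for v
    by (auto simp: incident_edges_def)
  have flow: "T_flow G (spanned_tetrahedron p) (?f M)" if M: "four_covering G M" for M
  proof -
    have vertex: "\<exists>k l. k \<noteq> l \<and> ?f M ` incident_edges G v = s ` {{k}, {l}, {k, l}}"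
      if v: "v \<in> verts G" for v
    proof -
      obtain k l where kl: "k \<noteq> l"
        and im: "(\<lambda>e. {i. e \<in> M i}) ` incident_edges G v = {{k}, {l}, - {k, l}}"
        using M v unfolding four_covering_iff_labels[OF cubic] by blast
      have "?f M ` incident_edges G v =
          s ` complement_pair ` (\<lambda>e. {i. e \<in> M i}) ` incident_edges G v"
        unfolding f image_image using I by (intro image_cong) auto
      with kl show ?thesis
        unfolding im complement_pair_triple(1)[OF kl] by blast
    qed
    \<comment> \<open>The value is read off at an end of \<open>e\<close>, where it belongs to a
      line of the tetrahedron.\<close>
    have "?f M e \<in> points (spanned_tetrahedron p)" if e: "e \<in> edges G" for e
    proof -
      obtain v where v: "v \<in> verts G" "e \<in> incident_edges G v"
        using edge_has_end[OF fg e] .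
      then obtain k l where kl: "k \<noteq> l" and "?f M e \<in> s ` {{k}, {l}, {k, l}}"
        using vertex[OF v(1)] imageI[OF v(2), of "?f M"] by metis
      moreover have "{{k}, {l}, {k, l}} \<subseteq> {A. card A = 1 \<or> card A = 2}"
        using kl by simp
      ultimately show ?thesis
        unfolding tetra by blast
    qed
    then have "?f M \<in> edges G \<rightarrow>\<^sub>E points (spanned_tetrahedron p)"
      by (auto simp: PiE_iff)
    then show ?thesis
      unfolding T_flow_def tetra(2) using vertex by blast
  qed
  have covering: "four_covering G (g \<phi>)" if \<phi>: "T_flow G (spanned_tetrahedron p) \<phi>" for \<phi>
    unfolding four_covering_iff_labels[OF cubic]
  proof (intro conjI allI ballI)
    show "g \<phi> i \<subseteq> edges G" for i by (auto simp: g_def)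
  next
    fix v assume "v \<in> verts G"
    then obtain k l where kl: "k \<noteq> l" and im: "\<phi> ` incident_edges G v = s ` {{k}, {l}, {k, l}}"
      using \<phi> unfolding T_flow_def tetra(2) by blast
    have "(\<lambda>e. {i. e \<in> g \<phi> i}) ` incident_edges G v =
        complement_pair ` inv s ` \<phi> ` incident_edges G v"
      unfolding image_image g_def using I by (intro image_cong) auto
    also have "\<dots> = {{k}, {l}, - {k, l}}"
      unfolding im image_inv_f_f[OF s] complement_pair_triple(2)[OF kl] ..
    finally show "\<exists>k l. k \<noteq> l \<and>
        (\<lambda>e. {i. e \<in> g \<phi> i}) ` incident_edges G v = {{k}, {l}, - {k, l}}"
      using kl by blast
  qed
  show ?thesis
  proof (rule bij_betw_byWitness[where f' = g])
    show "\<forall>M\<in>{M. four_covering G M}. g (?f M) = M"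
    proof
      fix M assume "M \<in> {M. four_covering G M}"
      then have "M i \<subseteq> edges G" for i
        using cubic by (simp add: four_covering_iff_labels)
      then show "g (?f M) = M"
        unfolding f g_def by (auto simp: inv_f_f[OF s] complement_pair_involution)
    qed
    show "\<forall>\<phi>\<in>{\<phi>. T_flow G (spanned_tetrahedron p) \<phi>}. ?f (g \<phi>) = \<phi>"
    proof
      fix \<phi> assume "\<phi> \<in> {\<phi>. T_flow G (spanned_tetrahedron p) \<phi>}"
      then have \<phi>: "\<phi> \<in> edges G \<rightarrow>\<^sub>E points (spanned_tetrahedron p)"
        by (simp add: T_flow_def)
      show "?f (g \<phi>) = \<phi>"
      \<comment> \<open>Off \<open>edges G\<close> both maps are \<open>undefined\<close>. On an
        edge, \<open>\<phi> e\<close> is a point and so lies in \<open>range s\<close>, where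
        \<open>s\<close> undoes \<open>inv s\<close>.\<close>
      proof (rule extensionalityI[of _ "edges G"])
        show "?f (g \<phi>) \<in> extensional (edges G)" by simp
        show "\<phi> \<in> extensional (edges G)" using \<phi> by (simp add: PiE_iff)
      next
        fix e assume e: "e \<in> edges G"
        with \<phi> have "\<phi> e \<in> range s"
          unfolding tetra(1) by blast
        with e show "?f (g \<phi>) e = \<phi> e"
          unfolding f by (simp add: g_def complement_pair_involution f_inv_into_f)
      qed
    qed
  qed (use flow covering in auto)
qed

theorem theorem3p1:
  fixes G :: "('v, 'e) multigraph"
  assumes "cubic_graph G"
  shows "((\<exists>M. four_covering G M) \<longleftrightarrow> (\<exists>\<phi>. tetrahedral_flow G \<phi>)) \<and>
    (\<forall>T. is_tetrahedron T \<longrightarrow>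
      (\<exists>f. bij_betw f {M. four_covering G M} {\<phi>. T_flow G T \<phi>}))"
proof -
  have bij: "\<exists>f. bij_betw f {M. four_covering G M} {\<phi>. T_flow G T \<phi>}"
    if "is_tetrahedron T" for T
    using that coverings_flows_bij_betw[OF assms] unfolding is_tetrahedron_def by blast
  then have ex: "(\<exists>M. four_covering G M) \<longleftrightarrow> (\<exists>\<phi>. T_flow G T \<phi>)" if T: "is_tetrahedron T" for T
  proof -
    obtain f where "bij_betw f {M. four_covering G M} {\<phi>. T_flow G T \<phi>}"
      using bij[OF T] ..
    then have "f ` {M. four_covering G M} = {\<phi>. T_flow G T \<phi>}"
      by (rule bij_betw_imp_surj_on)
    then have "{M. four_covering G M} = {} \<longleftrightarrow> {\<phi>. T_flow G T \<phi>} = {}"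
      by (metis image_is_empty)
    then show ?thesis
      unfolding Collect_empty_eq by blast
  qed
  have "is_tetrahedron (spanned_tetrahedron (\<lambda>i. axis i 1))"
    using general_position_axis is_tetrahedron_def by blast
  with ex bij show ?thesis
    unfolding tetrahedral_flow_def by blast
qed

end
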